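(* Let $\mathbb{F}$ be a field with $\mathrm{char}(\mathbb{F})>n$. Let $f=\prod_{1\le i<j\le n}(x_i+x_j-1)$ and $g=x_1+\cdots+x_n-n$ with $f,g\in\mathbb{F}[x_1,\ldots,x_n]$. Then the system $f,g,\{x_i^2-x_i\}_{i=1}^n$ is unsatisfiable and any roABP-IPS refutation of it (in any variable order) requires size $\ge\exp(\Omega(n))$.
   Context: An IPS refutation of $f,g,\{x_i^2-x_i\}_i$ is a polynomial $C(\overline{x},y,z,\overline{w})\in\mathbb{F}[x_1,\ldots,x_n,y,z,w_1,\ldots,w_n]$ (of arbitrary degree in $y,z,\overline{w}$), given by an algebraic circuit, with $C(\overline{x},0,0,\overline{0})=0$ and $C(\overline{x},f,g,x_1^2-x_1,\ldots,x_n^2-x_n)=1$ as polynomial identities. It is an roABP-IPS refutation if $C$ is given by an roABP in the variables $\overline{x},y,z,\overline{w}$ (in some variable order), and its size is the size of that roABP. A width-$r$ read-once oblivious algebraic branching program (roABP) on $N$ variables in variable order $v_1<\cdots<v_N$ is a directed acyclic graph with vertex layers $V_0=\{s\},V_1,\ldots,V_N=\{t\}$, $|V_i|\le r$, edges only from $V_{i-1}$ to $V_i$, each edge from $V_{i-1}$ to $V_i$ labelled by a univariate polynomial in $v_i$ of degree at most $d$; it computes the sum over all $s$–$t$ paths of the product of edge labels, and its size is $N\cdot r\cdot d\cdot N$. Unsatisfiable means no common zero. Convention: $\mathrm{char}(\mathbb{F})>n$ includes characteristic zero. The constant in $\Omega$ is absolute and positive. *)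

theory Defs
  imports "HOL-Library.Poly_Mapping" "HOL-Library.Disjoint_Sets"
    "HOL-Computational_Algebra.Computational_Algebra" Complex_Main
begin

section \<open>Multivariate polynomials\<close>

text \<open>A monomial is a finitely supported exponent vector, and a polynomial is a finitely supported
  map from monomials to coefficients; the ring operations are those of Poly_Mapping.\<close>

type_synonym ('x, 'a) mpoly = "('x \<Rightarrow>\<^sub>0 nat) \<Rightarrow>\<^sub>0 'a"

definition Const :: "'a \<Rightarrow> ('x, 'a::zero) mpoly" where
  "Const c = Poly_Mapping.single 0 c"

definition Var :: "'x \<Rightarrow> ('x, 'a::zero_neq_one) mpoly" where
  "Var v = Poly_Mapping.single (Poly_Mapping.single v 1) 1"

text \<open>Replace every coefficient \<open>c\<close> by \<open>h c\<close> and every variable \<open>v\<close> by \<open>\<sigma> v\<close>.\<close>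

definition mpoly_eval :: "('a \<Rightarrow> 'b) \<Rightarrow> ('x \<Rightarrow> 'b) \<Rightarrow> ('x, 'a::zero) mpoly \<Rightarrow> 'b::comm_semiring_1" where
  "mpoly_eval h \<sigma> p =
     (\<Sum>m\<in>Poly_Mapping.keys p. h (Poly_Mapping.lookup p m) *
        (\<Prod>v\<in>Poly_Mapping.keys m. \<sigma> v ^ Poly_Mapping.lookup m v))"

definition mpoly_at :: "('x \<Rightarrow> 'a) \<Rightarrow> ('x, 'a::comm_semiring_1) mpoly \<Rightarrow> 'a" where
  "mpoly_at = mpoly_eval (\<lambda>c. c)"

definition mpoly_subst :: "('x \<Rightarrow> ('y, 'a) mpoly) \<Rightarrow> ('x, 'a::comm_semiring_1) mpoly \<Rightarrow> ('y, 'a) mpoly" where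
  "mpoly_subst = mpoly_eval Const"

definition mpoly_vars :: "('x, 'a::zero) mpoly \<Rightarrow> 'x set" where
  "mpoly_vars p = (\<Union>m\<in>Poly_Mapping.keys p. Poly_Mapping.keys m)"

text \<open>The univariate polynomial \<open>q\<close>, read as a polynomial in the variable \<open>v\<close>.\<close>

definition univ_in :: "'x \<Rightarrow> 'a::comm_semiring_1 poly \<Rightarrow> ('x, 'a) mpoly" where
  "univ_in v q = poly (map_poly Const q) (Var v)"

definition unsatisfiable :: "('x, 'a::comm_semiring_1) mpoly set \<Rightarrow> bool" where
  "unsatisfiable S \<longleftrightarrow> \<not> (\<exists>a. \<forall>p\<in>S. mpoly_at a p = 0)"


section \<open>Read-once oblivious algebraic branching programs\<close>

text \<open>The variable order \<open>v\<^sub>1 < \<dots> < v\<^sub>N\<close> is the list \<open>var_order\<close>. List positions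
  count from 0, so the edges from layer \<open>i\<close> to layer \<open>Suc i\<close> carry polynomials in the variable
  \<open>var_order ! i\<close>.\<close>

record (overloaded) ('x, 'v, 'a) roabp =
  var_order :: "'x list"
  layer :: "nat \<Rightarrow> 'v set"
  edges :: "('v \<times> 'v) set"
  label :: "'v \<times> 'v \<Rightarrow> 'a poly"

definition num_vars :: "('x, 'v, 'a::zero) roabp \<Rightarrow> nat" where
  "num_vars B = length (var_order B)"

text \<open>\<open>B\<close> is a width-\<open>r\<close> roABP on the variable set \<open>V\<close> with edge labels of degree at most \<open>d\<close>.\<close>

definition is_roabp :: "'x set \<Rightarrow> nat \<Rightarrow> nat \<Rightarrow> ('x, 'v, 'a::zero) roabp \<Rightarrow> bool" where
  "is_roabp V r d B \<longleftrightarrow>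
     distinct (var_order B) \<and> set (var_order B) = V \<and>
     (\<exists>s. layer B 0 = {s}) \<and> (\<exists>t. layer B (num_vars B) = {t}) \<and>
     disjoint_family_on (layer B) {..num_vars B} \<and>
     (\<forall>i\<le>num_vars B. finite (layer B i) \<and> card (layer B i) \<le> r) \<and>
     edges B \<subseteq> (\<Union>i<num_vars B. layer B i \<times> layer B (Suc i)) \<and>
     (\<forall>e\<in>edges B. degree (label B e) \<le> d)"

text \<open>Source-sink paths as vertex lists. Every edge advances by one layer, so each
  such path has exactly \<open>num_vars B\<close> edges and its \<open>i\<close>-th vertex lies in layer \<open>i\<close>.\<close>

definition st_paths :: "('x, 'v, 'a::zero) roabp \<Rightarrow> 'v list set" where
  "st_paths B =
     {p. length p = Suc (num_vars B) \<and> p ! 0 \<in> layer B 0 \<and> p ! num_vars B \<in> layer B (num_vars B) \<and>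
         (\<forall>i<num_vars B. (p ! i, p ! Suc i) \<in> edges B)}"

definition roabp_poly :: "('x, 'v, 'a::comm_semiring_1) roabp \<Rightarrow> ('x, 'a) mpoly" where
  "roabp_poly B =
     (\<Sum>p\<in>st_paths B. \<Prod>i<num_vars B. univ_in (var_order B ! i) (label B (p ! i, p ! Suc i)))"

definition roabp_size :: "nat \<Rightarrow> nat \<Rightarrow> nat \<Rightarrow> nat" where
  "roabp_size N r d = N * r * d * N"


section \<open>IPS refutations of \<open>f, g, x\<^sub>1\<^sup>2 - x\<^sub>1, \<dots>, x\<^sub>n\<^sup>2 - x\<^sub>n\<close>\<close>

text \<open>Polynomials in \<open>x\<^sub>1, \<dots>, x\<^sub>n\<close> have variables of type \<^typ>\<open>nat\<close>, of which \<open>1, \<dots>, n\<close> are used.\<close>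

datatype ips_var = XVar nat | YVar | ZVar | WVar nat

definition ips_vars :: "nat \<Rightarrow> ips_var set" where
  "ips_vars n = XVar ` {1..n} \<union> {YVar, ZVar} \<union> WVar ` {1..n}"

definition bool_axiom :: "nat \<Rightarrow> (nat, 'a::comm_ring_1) mpoly" where
  "bool_axiom i = Var i ^ 2 - Var i"

fun ips_zero_subst :: "ips_var \<Rightarrow> (nat, 'a::comm_ring_1) mpoly" where
  "ips_zero_subst (XVar i) = Var i"
| "ips_zero_subst YVar = 0"
| "ips_zero_subst ZVar = 0"
| "ips_zero_subst (WVar i) = 0"

fun ips_axiom_subst ::
  "(nat, 'a::comm_ring_1) mpoly \<Rightarrow> (nat, 'a) mpoly \<Rightarrow> ips_var \<Rightarrow> (nat, 'a) mpoly" where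
  "ips_axiom_subst f g (XVar i) = Var i"
| "ips_axiom_subst f g YVar = f"
| "ips_axiom_subst f g ZVar = g"
| "ips_axiom_subst f g (WVar i) = bool_axiom i"

definition ips_refutation ::
  "nat \<Rightarrow> (nat, 'a::comm_ring_1) mpoly \<Rightarrow> (nat, 'a) mpoly \<Rightarrow> (ips_var, 'a) mpoly \<Rightarrow> bool" where
  "ips_refutation n f g C \<longleftrightarrow>
     mpoly_vars C \<subseteq> ips_vars n \<and>
     mpoly_subst ips_zero_subst C = 0 \<and>
     mpoly_subst (ips_axiom_subst f g) C = 1"

definition roabp_ips_refutation ::
  "nat \<Rightarrow> (nat, 'a::comm_ring_1) mpoly \<Rightarrow> (nat, 'a) mpoly \<Rightarrow> nat \<Rightarrow> nat \<Rightarrow>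
   (ips_var, 'v, 'a) roabp \<Rightarrow> bool" where
  "roabp_ips_refutation n f g r d B \<longleftrightarrow>
     is_roabp (ips_vars n) r d B \<and> ips_refutation n f g (roabp_poly B)"


section \<open>The system\<close>

definition hard_f :: "nat \<Rightarrow> (nat, 'a::comm_ring_1) mpoly" where
  "hard_f n = (\<Prod>(i, j)\<in>{(i, j). 1 \<le> i \<and> i < j \<and> j \<le> n}. Var i + Var j - 1)"

definition hard_g :: "nat \<Rightarrow> (nat, 'a::comm_ring_1) mpoly" where
  "hard_g n = (\<Sum>i\<in>{1..n}. Var i) - of_nat n"

text \<open>The absolute constant hidden in \<open>\<Omega>(n)\<close>. In HOL an existential quantifier inside a
  theorem about a field type \<open>'a\<close> yields a constant that may depend on \<open>'a\<close>; a
  closed real number is needed to make it the same for all fields. Its particular value has no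
  significance.\<close>

definition hardness_const :: real where
  "hardness_const = 1 / 10000"

end

theory Submission
  imports Defs
begin

text \<open>Let \<open>C\<close> be a refutation and \<open>G(x) = 1 - C(x, 0, g(x), x\<^sup>2 - x)\<close>. Then \<open>G\<close> vanishes at every zero of \<open>f\<close>,
  while \<open>G(1, \<dots>, 1) = 1\<close> because \<open>g\<close> and the Boolean axioms vanish at the all-ones point. All evaluations
  take place in \<open>\<bbbF>[t]\<close>, since \<open>\<bbbF>\<close> may be finite.

  Let \<open>A\<close>, \<open>D\<close> be disjoint sets of \<open>m\<close> variables and \<open>\<pi>\<close> a bijection between them. Choosing for each \<open>a\<close>
  one of two generic values for \<open>x\<^sub>a\<close>, and one of the two complementary values for \<open>x\<close> at \<open>\<pi> a\<close>, one gets a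
  \<open>2\<^sup>m \<times> 2\<^sup>m\<close> matrix of values of \<open>G\<close> that is diagonal with nonzero diagonal: off the diagonal some factor
  \<open>x\<^sub>i + x\<^sub>j - 1\<close> of \<open>f\<close> vanishes. So \<open>G\<close> has rank at least \<open>2\<^sup>m\<close> across \<open>A\<close> and \<open>D\<close>.

  On the other hand, after the substitution every \<open>x\<^sub>i\<close> is read at the two positions of \<open>x\<^sub>i\<close> and \<open>w\<^sub>i\<close>.
  Repeated halving yields \<open>A\<close> and \<open>D\<close> of size \<open>n div 32\<close> whose positions are separated by four thresholds, so
  the program alternates at most four times between reading \<open>A\<close> and reading \<open>D\<close>. Each alternation costs a
  factor \<open>r\<close> in the rank, and the layer of \<open>z\<close>, into which \<open>g = g\<^sub>A + g\<^sub>D\<close> is substituted, a factor \<open>d + 1\<close>.\<close>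

section \<open>Evaluation of multivariate polynomials\<close>

definition monomial_eval :: "('x \<Rightarrow> 'b) \<Rightarrow> ('x \<Rightarrow>\<^sub>0 nat) \<Rightarrow> 'b::comm_semiring_1" where
  "monomial_eval \<sigma> m = (\<Prod>v\<in>Poly_Mapping.keys m. \<sigma> v ^ Poly_Mapping.lookup m v)"

lemma monomial_eval_superset:
  assumes "finite S" "Poly_Mapping.keys m \<subseteq> S"
  shows "monomial_eval \<sigma> m = (\<Prod>v\<in>S. \<sigma> v ^ Poly_Mapping.lookup m v)"
  unfolding monomial_eval_def
  by (rule prod.mono_neutral_left) (use assms in \<open>auto simp: in_keys_iff\<close>)

lemma monomial_eval_zero [simp]: "monomial_eval \<sigma> 0 = 1"
  by (simp add: monomial_eval_def)

lemma monomial_eval_add: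
  "monomial_eval \<sigma> (m + m') = monomial_eval \<sigma> m * monomial_eval \<sigma> m'"
proof -
  let ?S = "Poly_Mapping.keys m \<union> Poly_Mapping.keys m'"
  have "monomial_eval \<sigma> (m + m') = (\<Prod>v\<in>?S. \<sigma> v ^ Poly_Mapping.lookup (m + m') v)"
    by (rule monomial_eval_superset) (auto dest: keys_add[THEN subsetD])
  also have "\<dots> = (\<Prod>v\<in>?S. \<sigma> v ^ Poly_Mapping.lookup m v) * (\<Prod>v\<in>?S. \<sigma> v ^ Poly_Mapping.lookup m' v)"
    by (simp add: lookup_add power_add prod.distrib)
  finally show ?thesis
    by (simp add: monomial_eval_superset[of ?S])
qed

lemma poly_mapping_sum_single:
  "(\<Sum>m\<in>Poly_Mapping.keys p. Poly_Mapping.single m (Poly_Mapping.lookup p m)) = p"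
  by (rule poly_mapping_eqI) (auto simp: lookup_sum lookup_single when_def in_keys_iff)

lemma poly_map_poly_sum:
  fixes h :: "'a::zero \<Rightarrow> 'b::comm_semiring_1"
  assumes "h 0 = 0" "degree q \<le> d"
  shows "poly (map_poly h q) x = (\<Sum>i\<le>d. h (coeff q i) * x ^ i)"
proof -
  have "degree (map_poly h q) \<le> d"
    using map_poly_degree_leq[of h q] assms(2) by simp
  then have "poly (map_poly h q) x = (\<Sum>i\<le>d. coeff (map_poly h q) i * x ^ i)"
    unfolding poly_altdef
    by (intro sum.mono_neutral_left) (auto simp: coeff_eq_0)
  then show ?thesis
    by (simp add: coeff_map_poly assms(1))
qed

locale coeff_hom =
  fixes h :: "'a::comm_ring_1 \<Rightarrow> 'b::idom"
  assumes hom_add: "h (a + b) = h a + h b"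
    and hom_mult: "h (a * b) = h a * h b"
    and hom_one [simp]: "h 1 = 1"
begin

lemma hom_zero [simp]: "h 0 = 0"
  using hom_add[of 0 0] add_cancel_left_right[of "h 0" "h 0"] by (simp only: add_0_right simp_thms)

lemma eval_superset:
  assumes "finite S" "Poly_Mapping.keys p \<subseteq> S"
  shows "mpoly_eval h \<sigma> p = (\<Sum>m\<in>S. h (Poly_Mapping.lookup p m) * monomial_eval \<sigma> m)"
  unfolding mpoly_eval_def monomial_eval_def
  by (rule sum.mono_neutral_left) (use assms in \<open>auto simp: in_keys_iff\<close>)

lemma eval_zero [simp]: "mpoly_eval h \<sigma> 0 = 0"
  by (simp add: mpoly_eval_def)

lemma eval_add: "mpoly_eval h \<sigma> (p + q) = mpoly_eval h \<sigma> p + mpoly_eval h \<sigma> q"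
proof -
  let ?S = "Poly_Mapping.keys p \<union> Poly_Mapping.keys q"
  have "mpoly_eval h \<sigma> (p + q) = (\<Sum>m\<in>?S. h (Poly_Mapping.lookup (p + q) m) * monomial_eval \<sigma> m)"
    by (rule eval_superset) (auto dest: keys_add[THEN subsetD])
  also have "\<dots> = (\<Sum>m\<in>?S. h (Poly_Mapping.lookup p m) * monomial_eval \<sigma> m) +
      (\<Sum>m\<in>?S. h (Poly_Mapping.lookup q m) * monomial_eval \<sigma> m)"
    by (simp add: lookup_add hom_add algebra_simps sum.distrib)
  finally show ?thesis
    by (simp add: eval_superset[of ?S])
qed

lemma eval_diff: "mpoly_eval h \<sigma> (p - q) = mpoly_eval h \<sigma> p - mpoly_eval h \<sigma> q"
  using eval_add[of \<sigma> "p - q" q] by simp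

lemma eval_sum: "mpoly_eval h \<sigma> (\<Sum>i\<in>I. p i) = (\<Sum>i\<in>I. mpoly_eval h \<sigma> (p i))"
  by (induction I rule: infinite_finite_induct) (simp_all add: eval_add)

lemma eval_single: "mpoly_eval h \<sigma> (Poly_Mapping.single m c) = h c * monomial_eval \<sigma> m"
  by (subst eval_superset[of "{m}"]) (auto split: if_splits)

lemma eval_Const: "mpoly_eval h \<sigma> (Const c) = h c"
  by (simp add: Const_def eval_single)

lemma eval_one [simp]: "mpoly_eval h \<sigma> 1 = 1"
  using eval_single[of \<sigma> 0 1] by simp

lemma eval_Var [simp]: "mpoly_eval h \<sigma> (Var v) = \<sigma> v"
  by (simp add: Var_def eval_single monomial_eval_def)

lemma eval_mult: "mpoly_eval h \<sigma> (p * q) = mpoly_eval h \<sigma> p * mpoly_eval h \<sigma> q"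
proof -
  let ?s = "\<lambda>p m. Poly_Mapping.single m (Poly_Mapping.lookup p m)"
  have "p * q = (\<Sum>m\<in>Poly_Mapping.keys p. ?s p m) * (\<Sum>m'\<in>Poly_Mapping.keys q. ?s q m')"
    by (simp add: poly_mapping_sum_single)
  also have "\<dots> = (\<Sum>m\<in>Poly_Mapping.keys p. \<Sum>m'\<in>Poly_Mapping.keys q.
      Poly_Mapping.single (m + m') (Poly_Mapping.lookup p m * Poly_Mapping.lookup q m'))"
    by (simp add: sum_product mult_single)
  finally have "mpoly_eval h \<sigma> (p * q) = (\<Sum>m\<in>Poly_Mapping.keys p. \<Sum>m'\<in>Poly_Mapping.keys q.
      (h (Poly_Mapping.lookup p m) * monomial_eval \<sigma> m) *
      (h (Poly_Mapping.lookup q m') * monomial_eval \<sigma> m'))"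
    by (simp add: eval_sum eval_single hom_mult monomial_eval_add mult_ac)
  also have "\<dots> = mpoly_eval h \<sigma> p * mpoly_eval h \<sigma> q"
    by (simp add: sum_product eval_superset[of "Poly_Mapping.keys p" p]
        eval_superset[of "Poly_Mapping.keys q" q])
  finally show ?thesis .
qed

lemma eval_prod: "mpoly_eval h \<sigma> (\<Prod>i\<in>I. p i) = (\<Prod>i\<in>I. mpoly_eval h \<sigma> (p i))"
  by (induction I rule: infinite_finite_induct) (simp_all add: eval_mult)

lemma eval_power: "mpoly_eval h \<sigma> (p ^ k) = mpoly_eval h \<sigma> p ^ k"
  by (induction k) (simp_all add: eval_mult)

lemma eval_of_nat: "mpoly_eval h \<sigma> (of_nat k) = of_nat k"
  by (induction k) (simp_all add: eval_add)

lemma eval_subst: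
  "mpoly_eval h \<sigma> (mpoly_subst \<tau> p) = mpoly_eval h (\<lambda>v. mpoly_eval h \<sigma> (\<tau> v)) p"
  by (simp add: mpoly_subst_def mpoly_eval_def[of Const] eval_sum eval_mult eval_prod
      eval_power eval_Const mpoly_eval_def[of h "\<lambda>v. mpoly_eval h \<sigma> (\<tau> v)"])

lemma eval_univ_in: "mpoly_eval h \<sigma> (univ_in v q) = poly (map_poly h q) (\<sigma> v)"
  by (simp add: univ_in_def poly_map_poly_sum[of _ q "degree q"] Const_def eval_sum eval_mult
      eval_power eval_single)

lemma eval_hard_f:
  "mpoly_eval h \<sigma> (hard_f n) = (\<Prod>(i, j)\<in>{(i, j). 1 \<le> i \<and> i < j \<and> j \<le> n}. \<sigma> i + \<sigma> j - 1)"
  by (simp add: hard_f_def eval_prod case_prod_unfold eval_add eval_diff)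

lemma eval_hard_g: "mpoly_eval h \<sigma> (hard_g n) = (\<Sum>i\<in>{1..n}. \<sigma> i) - of_nat n"
  by (simp add: hard_g_def eval_sum eval_diff eval_of_nat)

lemma eval_bool_axiom: "mpoly_eval h \<sigma> (bool_axiom i) = \<sigma> i ^ 2 - \<sigma> i"
  by (simp add: bool_axiom_def eval_diff eval_power)

lemma eval_hard_f_eq_0:
  assumes "i \<in> {1..n}" "j \<in> {1..n}" "i \<noteq> j" "\<sigma> i + \<sigma> j = 1"
  shows "mpoly_eval h \<sigma> (hard_f n) = 0"
proof -
  let ?P = "{(i, j). 1 \<le> i \<and> i < j \<and> j \<le> n}"
  have "?P \<subseteq> {1..n} \<times> {1..n}" by auto
  then have "finite ?P" by (rule finite_subset) simp
  moreover have "\<exists>k\<in>?P. (case k of (i, j) \<Rightarrow> \<sigma> i + \<sigma> j - 1) = 0"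
  proof (cases "i < j")
    case True
    with assms show ?thesis by (intro bexI[of _ "(i, j)"]) simp_all
  next
    case False
    with assms show ?thesis by (intro bexI[of _ "(j, i)"]) (simp_all add: add.commute)
  qed
  ultimately show ?thesis
    unfolding eval_hard_f by (rule prod_zero)
qed

end

lemma hard_system_unsatisfiable:
  assumes "CHAR('a::field) = 0 \<or> CHAR('a) > n"
  shows "unsatisfiable ({hard_f n, hard_g n} \<union> bool_axiom ` {1..n} :: (nat, 'a) mpoly set)"
  unfolding unsatisfiable_def
proof (rule notI, erule exE)
  have hom: "coeff_hom (\<lambda>c::'a. c)" by unfold_locales auto
  fix a :: "nat \<Rightarrow> 'a"
  assume all: "\<forall>p\<in>{hard_f n, hard_g n} \<union> bool_axiom ` {1..n}. mpoly_at a p = 0"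
  have ax: "mpoly_eval (\<lambda>c. c) a (bool_axiom i) = 0" if "i \<in> {1..n}" for i
    using all that by (simp add: mpoly_at_def)
  have bool: "a i = 0 \<or> a i = 1" if "Suc 0 \<le> i" "i \<le> n" for i
  proof -
    have "a i * (a i - 1) = 0"
      using ax[of i] that by (simp add: coeff_hom.eval_bool_axiom[OF hom] power2_eq_square algebra_simps)
    then show ?thesis by auto
  qed
  define O' where "O' = {i\<in>{1..n}. a i = 1}"
  have sub: "O' \<subseteq> {1..n}" by (auto simp: O'_def)
  have "(\<Sum>i\<in>{1..n}. a i) = (\<Sum>i\<in>O'. 1)"
    by (rule sum.mono_neutral_cong_right) (auto simp: O'_def dest: bool)
  then have "(of_nat (card O') :: 'a) = of_nat n"
    using all by (simp add: mpoly_at_def coeff_hom.eval_hard_g[OF hom])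
  moreover have le: "card O' \<le> n"
    using card_mono[OF _ sub] by simp
  ultimately have "(of_nat (n - card O') :: 'a) = 0"
    by (simp only: of_nat_diff) simp
  then have dvd: "CHAR('a) dvd n - card O'"
    by (simp only: of_nat_eq_0_iff_char_dvd)
  have "n - card O' = 0"
  proof (rule ccontr)
    assume "n - card O' \<noteq> 0"
    moreover from this have "CHAR('a) \<le> n - card O'"
      using dvd by (intro dvd_imp_le) simp_all
    ultimately show False
      using assms dvd by auto
  qed
  then have "card O' = card {1..n}"
    using le by simp
  then have eq: "O' = {1..n}"
    using card_subset_eq[OF _ sub] by simp
  have all1: "a i = 1" if "i \<in> {1..n}" for i
    using eqset_imp_iff[OF eq, of i] that by (simp add: O'_def)
  have "mpoly_eval (\<lambda>c. c) a (hard_f n) = (1::'a)"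
    unfolding coeff_hom.eval_hard_f[OF hom] by (rule prod.neutral) (auto simp: all1)
  then show False
    using all by (simp add: mpoly_at_def)
qed

section \<open>Rank and generic points\<close>

lemma exists_nontrivial_relation:
  fixes a :: "nat \<Rightarrow> 'e \<Rightarrow> 'b::idom"
  assumes "finite E" "n < card E"
  shows "\<exists>c. (\<exists>e\<in>E. c e \<noteq> 0) \<and> (\<forall>k<n. (\<Sum>e\<in>E. c e * a k e) = 0)"
  using assms
proof (induction n arbitrary: E a)
  case 0
  then obtain e where "e \<in> E" by (metis card.empty ex_in_conv less_irrefl)
  then show ?case by (intro exI[of _ "\<lambda>_. 1"]) auto
next
  case (Suc n)
  show ?case
  proof (cases "\<forall>e\<in>E. a n e = 0")
    case True
    obtain c where "\<exists>e\<in>E. c e \<noteq> 0" "\<forall>k<n. (\<Sum>e\<in>E. c e * a k e) = 0"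
      using Suc.IH[of E a] Suc.prems by auto
    then show ?thesis
      using True by (intro exI[of _ c]) (auto simp: less_Suc_eq)
  next
    case False
    then obtain e0 where e0: "e0 \<in> E" "a n e0 \<noteq> 0" by blast
    define E' where "E' = E - {e0}"
    have E': "finite E'" "n < card E'" "E = insert e0 E'" "e0 \<notin> E'"
      using Suc.prems e0(1) by (auto simp: E'_def)
    obtain c where c: "\<exists>e\<in>E'. c e \<noteq> 0"
      "\<forall>k<n. (\<Sum>e\<in>E'. c e * (a n e0 * a k e - a k e0 * a n e)) = 0"
      using Suc.IH[of E' "\<lambda>k e. a n e0 * a k e - a k e0 * a n e"] E' by auto
    define c' where "c' e = (if e = e0 then - (\<Sum>e\<in>E'. c e * a n e) else a n e0 * c e)" for e
    have "(\<Sum>e\<in>E. c' e * a k e) = (\<Sum>e\<in>E'. c e * (a n e0 * a k e - a k e0 * a n e))" for k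
    proof -
      have "(\<Sum>e\<in>E'. c' e * a k e) = (\<Sum>e\<in>E'. a n e0 * c e * a k e)"
        by (rule sum.cong) (use E'(4) in \<open>auto simp: c'_def\<close>)
      then show ?thesis
        using E' by (simp add: c'_def sum_distrib_left sum_distrib_right sum_subtractf algebra_simps)
    qed
    then have "\<forall>k<Suc n. (\<Sum>e\<in>E. c' e * a k e) = 0"
      using c(2) by (auto simp: less_Suc_eq)
    moreover have "\<exists>e\<in>E. c' e \<noteq> 0"
      using c(1) e0(2) E' by (auto simp: c'_def)
    ultimately show ?thesis by blast
  qed
qed

lemma card_le_rank_of_diagonal:
  fixes x y :: "nat \<Rightarrow> 'e \<Rightarrow> 'b::idom"
  assumes "finite E"
    and off_diag: "\<And>e e'. e \<in> E \<Longrightarrow> e' \<in> E \<Longrightarrow> e \<noteq> e' \<Longrightarrow> (\<Sum>k<n. x k e * y k e') = 0"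
    and diag: "\<And>e. e \<in> E \<Longrightarrow> (\<Sum>k<n. x k e * y k e) \<noteq> 0"
  shows "card E \<le> n"
proof (rule ccontr)
  assume "\<not> card E \<le> n"
  then obtain c e' where c: "e' \<in> E" "c e' \<noteq> 0" "\<forall>k<n. (\<Sum>e\<in>E. c e * x k e) = 0"
    using exists_nontrivial_relation[of E n x] assms(1) by auto
  have "c e' * (\<Sum>k<n. x k e' * y k e') = (\<Sum>e\<in>E. c e * (\<Sum>k<n. x k e * y k e'))"
    using c(1) assms(1) off_diag by (simp add: sum.remove[of E e'])
  also have "\<dots> = (\<Sum>k<n. (\<Sum>e\<in>E. c e * x k e) * y k e')"
    unfolding sum_distrib_left sum_distrib_right by (subst sum.swap) (simp add: mult_ac)
  also have "\<dots> = 0"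
    using c(3) by simp
  finally show False
    using c(1,2) diag by simp
qed

definition line_poly :: "(('x \<Rightarrow> 'b::comm_ring_1) \<Rightarrow> 'b) \<Rightarrow> bool" where
  "line_poly \<Phi> \<longleftrightarrow> (\<forall>\<sigma> \<tau>. \<exists>q. \<forall>c. \<Phi> (\<lambda>i. \<sigma> i + c * (\<tau> i - \<sigma> i)) = poly q c)"

lemma line_poly_const [intro]: "line_poly (\<lambda>_. c)"
  unfolding line_poly_def by (auto intro: exI[of _ "[:c:]"])

lemma line_poly_coord [intro]: "line_poly (\<lambda>\<sigma>. \<sigma> i)"
  unfolding line_poly_def
proof (intro allI)
  fix \<sigma> \<tau> :: "'a \<Rightarrow> 'b"
  show "\<exists>q. \<forall>c. \<sigma> i + c * (\<tau> i - \<sigma> i) = poly q c"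
    by (rule exI[of _ "[:\<sigma> i, \<tau> i - \<sigma> i:]"]) simp
qed

lemma line_poly_add [intro]:
  assumes "line_poly \<Phi>" "line_poly \<Psi>"
  shows "line_poly (\<lambda>\<sigma>. \<Phi> \<sigma> + \<Psi> \<sigma>)"
  using assms unfolding line_poly_def by (metis poly_add)

lemma line_poly_diff [intro]:
  assumes "line_poly \<Phi>" "line_poly \<Psi>"
  shows "line_poly (\<lambda>\<sigma>. \<Phi> \<sigma> - \<Psi> \<sigma>)"
  using assms unfolding line_poly_def by (metis poly_diff)

lemma line_poly_mult [intro]:
  assumes "line_poly \<Phi>" "line_poly \<Psi>"
  shows "line_poly (\<lambda>\<sigma>. \<Phi> \<sigma> * \<Psi> \<sigma>)"
  using assms unfolding line_poly_def by (metis poly_mult)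

lemma line_poly_power [intro]: "line_poly \<Phi> \<Longrightarrow> line_poly (\<lambda>\<sigma>. \<Phi> \<sigma> ^ k)"
  by (induction k) auto

lemma line_poly_sum [intro]:
  "(\<And>i. i \<in> I \<Longrightarrow> line_poly (\<Phi> i)) \<Longrightarrow> line_poly (\<lambda>\<sigma>. \<Sum>i\<in>I. \<Phi> i \<sigma>)"
  by (induction I rule: infinite_finite_induct) auto

lemma line_poly_prod [intro]:
  "(\<And>i. i \<in> I \<Longrightarrow> line_poly (\<Phi> i)) \<Longrightarrow> line_poly (\<lambda>\<sigma>. \<Prod>i\<in>I. \<Phi> i \<sigma>)"
  by (induction I rule: infinite_finite_induct) auto

lemma line_poly_mpoly_eval [intro]:
  "(\<And>v. line_poly (\<lambda>\<sigma>. s \<sigma> v)) \<Longrightarrow> line_poly (\<lambda>\<sigma>. mpoly_eval h (s \<sigma>) p)"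
  unfolding mpoly_eval_def by (intro line_poly_sum line_poly_mult line_poly_prod line_poly_power) auto

lemma line_poly_common_nonzero_two:
  fixes \<Phi> \<Psi> :: "('x \<Rightarrow> 'b::idom) \<Rightarrow> 'b"
  assumes "infinite (UNIV :: 'b set)" "line_poly \<Phi>" "line_poly \<Psi>" "\<Phi> \<sigma> \<noteq> 0" "\<Psi> \<tau> \<noteq> 0"
  shows "\<exists>\<rho>. \<Phi> \<rho> \<noteq> 0 \<and> \<Psi> \<rho> \<noteq> 0"
proof -
  define l where "l c i = \<sigma> i + c * (\<tau> i - \<sigma> i)" for c i
  obtain p q where p: "\<And>c. \<Phi> (l c) = poly p c" and q: "\<And>c. \<Psi> (l c) = poly q c"
    using assms(2,3) unfolding line_poly_def l_def by metis
  have "l 0 = \<sigma>" "l 1 = \<tau>"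
    by (auto simp: l_def)
  then have "p \<noteq> 0" "q \<noteq> 0"
    using p[of 0] q[of 1] assms(4,5) by auto
  then have "finite {c. poly (p * q) c = 0}"
    by (intro poly_roots_finite) simp
  then obtain c where "poly (p * q) c \<noteq> 0"
    using assms(1) by (metis (mono_tags, lifting) UNIV_I finite_subset mem_Collect_eq subsetI)
  then show ?thesis
    using p q by (intro exI[of _ "l c"]) auto
qed

lemma line_poly_common_nonzero:
  fixes \<Phi> :: "'i \<Rightarrow> ('x \<Rightarrow> 'b::idom) \<Rightarrow> 'b"
  assumes "infinite (UNIV :: 'b set)" "finite I"
    and "\<And>i. i \<in> I \<Longrightarrow> line_poly (\<Phi> i)" "\<And>i. i \<in> I \<Longrightarrow> \<exists>\<sigma>. \<Phi> i \<sigma> \<noteq> 0"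
  shows "\<exists>\<sigma>. \<forall>i\<in>I. \<Phi> i \<sigma> \<noteq> 0"
  using assms(2-4)
proof (induction I rule: finite_induct)
  case (insert i I)
  then obtain \<sigma> \<tau> where "\<Phi> i \<sigma> \<noteq> 0" "(\<Prod>j\<in>I. \<Phi> j \<tau>) \<noteq> 0"
    by auto metis
  then obtain \<rho> where "\<Phi> i \<rho> \<noteq> 0" "(\<Prod>j\<in>I. \<Phi> j \<rho>) \<noteq> 0"
    using line_poly_common_nonzero_two[OF assms(1), of "\<Phi> i" "\<lambda>\<sigma>. \<Prod>j\<in>I. \<Phi> j \<sigma>" \<sigma> \<tau>] insert.prems
    by auto
  then show ?case
    using insert.hyps by (intro exI[of _ \<rho>]) auto
qed auto

section \<open>Separating the positions of two sets of variables\<close>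

lemma median_threshold:
  fixes \<phi> :: "'i \<Rightarrow> nat"
  assumes "finite A" "inj_on \<phi> A" "k \<le> card A"
  shows "\<exists>t. card {a\<in>A. \<phi> a < t} = k"
proof -
  define c where "c t = card {a\<in>A. \<phi> a < t}" for t
  have step: "c (Suc t) \<le> Suc (c t)" for t
  proof -
    have "card {a\<in>A. \<phi> a = t} \<le> 1"
      using assms(1,2) by (auto simp: card_le_Suc0_iff_eq inj_on_def)
    moreover have "{a\<in>A. \<phi> a < Suc t} = {a\<in>A. \<phi> a < t} \<union> {a\<in>A. \<phi> a = t}"
      by auto
    ultimately show ?thesis
      using card_Un_le[of "{a\<in>A. \<phi> a < t}" "{a\<in>A. \<phi> a = t}"] by (simp add: c_def)
  qed
  obtain T where "\<forall>x\<in>\<phi> ` A. x < T"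
    using assms(1) finite_nat_set_iff_bounded by blast
  then have "{a\<in>A. \<phi> a < T} = A"
    by auto
  then have "\<exists>t. k \<le> c t"
    using assms(3) by (intro exI[of _ T]) (simp add: c_def)
  then obtain t where t: "k \<le> c t" "\<forall>t'<t. \<not> k \<le> c t'"
    using exists_least_iff[of "\<lambda>t. k \<le> c t"] by blast
  have "c t = k"
  proof (cases t)
    case 0
    then show ?thesis using t by (simp add: c_def)
  next
    case (Suc u)
    then show ?thesis using t step[of u] by (metis le_antisym lessI not_less_eq_eq order_trans)
  qed
  then show ?thesis
    by (auto simp: c_def)
qed

lemma card_filter_not:
  assumes "finite X"
  shows "card {x\<in>X. \<not> P x} + card {x\<in>X. P x} = card X"
proof -
  have "{x\<in>X. \<not> P x} = X - {x\<in>X. P x}" by blast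
  then show ?thesis
    using assms card_mono[of X "{x\<in>X. P x}"] by (simp add: card_Diff_subset)
qed

lemma halving:
  fixes \<phi> :: "'i \<Rightarrow> nat" and \<psi> :: "'j \<Rightarrow> nat"
  assumes "finite A" "finite B" "inj_on \<phi> A" "card A = 2 * k" "card B = 2 * k"
  obtains A' B' t where "A' \<subseteq> A" "B' \<subseteq> B" "card A' = k" "card B' = k"
    "\<forall>a\<in>A'. \<forall>b\<in>B'. (\<phi> a < t) \<noteq> (\<psi> b < t)"
proof -
  obtain t where t: "card {a\<in>A. \<phi> a < t} = k"
    using median_threshold[of A \<phi> k] assms by auto
  have t': "card {a\<in>A. \<not> \<phi> a < t} = k"
    using card_filter_not[OF assms(1), of "\<lambda>a. \<phi> a < t"] t assms(4) by simp
  note B = card_filter_not[OF assms(2), of "\<lambda>b. \<psi> b < t"]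
  show thesis
  proof (cases "k \<le> card {b\<in>B. \<psi> b < t}")
    case True
    then obtain B' where B': "B' \<subseteq> {b\<in>B. \<psi> b < t}" "card B' = k"
      by (rule obtain_subset_with_card_n)
    show thesis
      by (rule that[OF _ _ t' B'(2)]) (use B'(1) in blast)+
  next
    case False
    then have "k \<le> card {b\<in>B. \<not> \<psi> b < t}"
      using B assms(5) by linarith
    then obtain B' where B': "B' \<subseteq> {b\<in>B. \<not> \<psi> b < t}" "card B' = k"
      by (rule obtain_subset_with_card_n)
    show thesis
      by (rule that[OF _ _ t B'(2)]) (use B'(1) in blast)+
  qed
qed

lemma separated_subsets:
  fixes p q :: "'i \<Rightarrow> nat"
  assumes "finite S" "inj_on p S" "inj_on q S" "32 * m \<le> card S"
  obtains A B T where "A \<subseteq> S" "B \<subseteq> S" "A \<inter> B = {}" "card A = m" "card B = m"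
    "finite T" "card T \<le> 4"
    "\<forall>\<phi>\<in>{p, q}. \<forall>\<psi>\<in>{p, q}. \<forall>a\<in>A. \<forall>b\<in>B. \<exists>t\<in>T. (\<phi> a < t) \<noteq> (\<psi> b < t)"
proof -
  have "16 * m \<le> card S"
    using assms(4) by simp
  then obtain A0 where A0: "A0 \<subseteq> S" "card A0 = 16 * m"
    by (rule obtain_subset_with_card_n)
  have "card (S - A0) = card S - 16 * m"
    using card_Diff_subset[of A0 S] A0 finite_subset[OF A0(1) assms(1)] by simp
  then have "16 * m \<le> card (S - A0)"
    using assms(4) by simp
  then obtain B0 where B0: "B0 \<subseteq> S - A0" "card B0 = 16 * m"
    by (rule obtain_subset_with_card_n)
  have finA: "finite X" "inj_on p X" "inj_on q X" if "X \<subseteq> A0" for X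
    using finite_subset[OF _ assms(1)] inj_on_subset[OF assms(2)] inj_on_subset[OF assms(3)]
      subset_trans[OF that A0(1)] by blast+
  have finB: "finite X" if "X \<subseteq> B0" for X
    using finite_subset[OF _ assms(1)] subset_trans[OF that B0(1)] by blast
  have c0: "card A0 = 2 * (8 * m)" "card B0 = 2 * (8 * m)"
    using A0(2) B0(2) by simp_all
  obtain A1 B1 t1 where 1: "A1 \<subseteq> A0" "B1 \<subseteq> B0" "card A1 = 8 * m" "card B1 = 8 * m"
    "\<forall>a\<in>A1. \<forall>b\<in>B1. (p a < t1) \<noteq> (p b < t1)"
    by (rule halving[OF finA(1)[OF order_refl] finB[OF order_refl] finA(2)[OF order_refl] c0, where \<psi> = p])
  have sub1: "A1 \<subseteq> A0" "B1 \<subseteq> B0" using 1(1,2) by auto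
  have c1: "card A1 = 2 * (4 * m)" "card B1 = 2 * (4 * m)"
    using 1(3,4) by simp_all
  obtain A2 B2 t2 where 2: "A2 \<subseteq> A1" "B2 \<subseteq> B1" "card A2 = 4 * m" "card B2 = 4 * m"
    "\<forall>a\<in>A2. \<forall>b\<in>B2. (p a < t2) \<noteq> (q b < t2)"
    by (rule halving[OF finA(1)[OF sub1(1)] finB[OF sub1(2)] finA(2)[OF sub1(1)] c1, where \<psi> = q])
  have sub2: "A2 \<subseteq> A0" "B2 \<subseteq> B0" using sub1 2(1,2) by auto
  have c2: "card A2 = 2 * (2 * m)" "card B2 = 2 * (2 * m)"
    using 2(3,4) by simp_all
  obtain A3 B3 t3 where 3: "A3 \<subseteq> A2" "B3 \<subseteq> B2" "card A3 = 2 * m" "card B3 = 2 * m"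
    "\<forall>a\<in>A3. \<forall>b\<in>B3. (q a < t3) \<noteq> (p b < t3)"
    by (rule halving[OF finA(1)[OF sub2(1)] finB[OF sub2(2)] finA(3)[OF sub2(1)] c2, where \<psi> = p])
  have sub3: "A3 \<subseteq> A0" "B3 \<subseteq> B0" using sub2 3(1,2) by auto
  have c3: "card A3 = 2 * (m)" "card B3 = 2 * (m)"
    using 3(3,4) by simp_all
  obtain A4 B4 t4 where 4: "A4 \<subseteq> A3" "B4 \<subseteq> B3" "card A4 = m" "card B4 = m"
    "\<forall>a\<in>A4. \<forall>b\<in>B4. (q a < t4) \<noteq> (q b < t4)"
    by (rule halving[OF finA(1)[OF sub3(1)] finB[OF sub3(2)] finA(3)[OF sub3(1)] c3, where \<psi> = q])
  have sub: "A4 \<subseteq> A3" "A4 \<subseteq> A2" "A4 \<subseteq> A1" "A4 \<subseteq> A0" "B4 \<subseteq> B3" "B4 \<subseteq> B2" "B4 \<subseteq> B1" "B4 \<subseteq> B0"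
    using 1(1,2) 2(1,2) 3(1,2) 4(1,2) by auto
  show thesis
  proof (rule that[of A4 B4 "{t1, t2, t3, t4}"])
    show "card {t1, t2, t3, t4} \<le> 4"
      using card_length[of "[t1, t2, t3, t4]"] by simp
    show "\<forall>\<phi>\<in>{p, q}. \<forall>\<psi>\<in>{p, q}. \<forall>a\<in>A4. \<forall>b\<in>B4. \<exists>t\<in>{t1, t2, t3, t4}. (\<phi> a < t) \<noteq> (\<psi> b < t)"
    proof (intro ballI)
      fix \<phi> \<psi> a b
      assume pq: "\<phi> \<in> {p, q}" "\<psi> \<in> {p, q}" and ab: "a \<in> A4" "b \<in> B4"
      have "(p a < t1) \<noteq> (p b < t1)"
        by (rule 1(5)[rule_format]) (use ab sub in blast)+
      moreover have "(p a < t2) \<noteq> (q b < t2)"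
        by (rule 2(5)[rule_format]) (use ab sub in blast)+
      moreover have "(q a < t3) \<noteq> (p b < t3)"
        by (rule 3(5)[rule_format]) (use ab sub in blast)+
      moreover have "(q a < t4) \<noteq> (q b < t4)"
        by (rule 4(5)[rule_format]) (use ab sub in blast)+
      ultimately show "\<exists>t\<in>{t1, t2, t3, t4}. (\<phi> a < t) \<noteq> (\<psi> b < t)"
        using pq by blast
    qed
    show "A4 \<subseteq> S" "B4 \<subseteq> S" "A4 \<inter> B4 = {}"
      using A0(1) B0(1) sub by blast+
  qed (simp_all add: 4(3,4))
qed

section \<open>Separable functions and branching programs\<close>

lemma sum_div_mod:
  fixes f :: "nat \<Rightarrow> nat \<Rightarrow> 'b::comm_monoid_add"
  shows "(\<Sum>k<m * n. f (k div n) (k mod n)) = (\<Sum>i<m. \<Sum>j<n. f i j)"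
proof -
  have "(\<Sum>k\<in>{i * n..<i * n + n}. f (k div n) (k mod n)) = (\<Sum>j<n. f i j)" for i
  proof -
    have "(\<Sum>k\<in>{0 + i * n..<n + i * n}. f (k div n) (k mod n)) =
        (\<Sum>j\<in>{0..<n}. f ((j + i * n) div n) ((j + i * n) mod n))"
      by (rule sum.shift_bounds_nat_ivl)
    also have "\<dots> = (\<Sum>j\<in>{0..<n}. f i j)"
      by (rule sum.cong) auto
    finally show ?thesis
      by (simp add: add.commute lessThan_atLeast0)
  qed
  then show ?thesis
    by (simp add: sum.nat_group[symmetric])
qed

definition separable :: "nat \<Rightarrow> 'u set \<Rightarrow> ('u \<Rightarrow> 'e \<Rightarrow> 'f \<Rightarrow> 'b::comm_semiring_1) \<Rightarrow> bool" where
  "separable R U \<Phi> \<longleftrightarrow>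
     (\<exists>x y. \<forall>u\<in>U. \<forall>e e'. \<Phi> u e e' = (\<Sum>k<R. x k u e * y k e'))"

lemma separableI:
  assumes "\<And>u e e'. u \<in> U \<Longrightarrow> \<Phi> u e e' = (\<Sum>k<R. x k u e * y k e')"
  shows "separable R U \<Phi>"
  using assms unfolding separable_def by blast

lemma separable_fst: "(\<And>u e e'. u \<in> U \<Longrightarrow> \<Phi> u e e' = x u e) \<Longrightarrow> separable 1 U \<Phi>"
  by (rule separableI[where x = "\<lambda>_. x" and y = "\<lambda>_ _. 1"]) simp

lemma separable_mono:
  assumes "separable R U \<Phi>" "R \<le> R'"
  shows "separable R' U \<Phi>"
proof -
  obtain x y where xy: "\<And>u e e'. u \<in> U \<Longrightarrow> \<Phi> u e e' = (\<Sum>k<R. x k u e * y k e')"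
    using assms(1) unfolding separable_def by blast
  have "(\<Sum>k<R. x k u e * y k e') = (\<Sum>k<R'. (if k < R then x k u e else 0) * y k e')" for u e e'
    by (rule sum.mono_neutral_cong_left) (use assms(2) in auto)
  then show ?thesis
    using xy by (intro separableI[where x = "\<lambda>k u e. if k < R then x k u e else 0" and y = y]) simp
qed

lemma separable_step:
  assumes "separable R U \<Phi>" "separable D (U \<times> V) (\<lambda>(u, v). M u v)"
  shows "separable (R * D) V (\<lambda>v e e'. \<Sum>u\<in>U. \<Phi> u e e' * M u v e e')"
proof -
  obtain x y where xy: "\<And>u e e'. u \<in> U \<Longrightarrow> \<Phi> u e e' = (\<Sum>k<R. x k u e * y k e')"
    using assms(1) unfolding separable_def by blast
  obtain x' y' where xy': "\<And>u v e e'. u \<in> U \<Longrightarrow> v \<in> V \<Longrightarrow>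
      M u v e e' = (\<Sum>k<D. x' k (u, v) e * y' k e')"
    using assms(2) unfolding separable_def by auto
  have "(\<Sum>u\<in>U. \<Phi> u e e' * M u v e e') =
      (\<Sum>i<R. \<Sum>j<D. (\<Sum>u\<in>U. x i u e * x' j (u, v) e) * (y i e' * y' j e'))" if "v \<in> V" for v e e'
  proof -
    have "(\<Sum>u\<in>U. \<Phi> u e e' * M u v e e') =
        (\<Sum>u\<in>U. \<Sum>i<R. \<Sum>j<D. (x i u e * x' j (u, v) e) * (y i e' * y' j e'))"
      using that by (intro sum.cong) (simp_all add: xy xy' sum_product mult_ac)
    also have "\<dots> = (\<Sum>i<R. \<Sum>u\<in>U. \<Sum>j<D. (x i u e * x' j (u, v) e) * (y i e' * y' j e'))"
      by (rule sum.swap)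
    also have "\<dots> = (\<Sum>i<R. \<Sum>j<D. \<Sum>u\<in>U. (x i u e * x' j (u, v) e) * (y i e' * y' j e'))"
      by (intro sum.cong refl sum.swap)
    finally show ?thesis
      by (simp add: sum_distrib_right)
  qed
  then show ?thesis
    by (intro separableI[where
          x = "\<lambda>k v e. \<Sum>u\<in>U. x (k div D) u e * x' (k mod D) (u, v) e" and
          y = "\<lambda>k e'. y (k div D) e' * y' (k mod D) e'"])
      (simp add: sum_div_mod[where f = "\<lambda>i j. (\<Sum>u\<in>U. x i u _ * x' j (u, _) _) * (y i _ * y' j _)"])
qed

text \<open>Naming the current vertex by a further summation index moves the dependence on the vertex
  from one factor to the other.\<close>

lemma separable_swap:
  assumes "separable R U \<Phi>" "finite U" "card U \<le> r"
  shows "separable (R * r) U (\<lambda>u e' e. \<Phi> u e e')"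
proof -
  obtain x y where xy: "\<And>u e e'. u \<in> U \<Longrightarrow> \<Phi> u e e' = (\<Sum>k<R. x k u e * y k e')"
    using assms(1) unfolding separable_def by blast
  obtain us where us: "bij_betw us {..<card U} U"
    using ex_bij_betw_nat_finite[OF assms(2)] by (auto simp: lessThan_atLeast0)
  have "\<Phi> u e e' = (\<Sum>i<R. \<Sum>j<card U. (if u = us j then y i e' else 0) * x i (us j) e)"
    if "u \<in> U" for u e e'
  proof -
    have "(\<Sum>j<card U. (if u = us j then y i e' else 0) * x i (us j) e) =
        (\<Sum>w\<in>U. (if u = w then y i e' else 0) * x i w e)" for i
      by (rule sum.reindex_bij_betw[OF us])
    also have "\<dots> i = y i e' * x i u e" for i
      using that assms(2) by (simp add: if_distrib[of "\<lambda>t. t * _"] cong: if_cong)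
    finally show ?thesis
      using that by (simp add: xy mult.commute)
  qed
  then have "separable (R * card U) U (\<lambda>u e' e. \<Phi> u e e')"
    by (intro separableI[where
          x = "\<lambda>k u e'. if u = us (k mod card U) then y (k div card U) e' else 0" and
          y = "\<lambda>k e. x (k div card U) (us (k mod card U)) e"])
      (simp add: sum_div_mod[where f = "\<lambda>i j. (if _ = us j then y i _ else 0) * x i (us j) _"])
  then show ?thesis
    by (rule separable_mono) (simp add: assms(3))
qed

definition separable_by :: "bool \<Rightarrow> nat \<Rightarrow> 'u set \<Rightarrow> ('u \<Rightarrow> 'e \<Rightarrow> 'e \<Rightarrow> 'b::comm_semiring_1) \<Rightarrow> bool" where
  "separable_by c R U \<Phi> = (if c then separable R U \<Phi> else separable R U (\<lambda>u e' e. \<Phi> u e e'))"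

fun forward :: "(nat \<Rightarrow> 'u set) \<Rightarrow> 'u \<Rightarrow> (nat \<Rightarrow> 'u \<Rightarrow> 'u \<Rightarrow> 'b::comm_semiring_1) \<Rightarrow> nat \<Rightarrow> 'u \<Rightarrow> 'b" where
  "forward lay s W 0 v = (if v = s then 1 else 0)"
| "forward lay s W (Suc i) v = (\<Sum>u\<in>lay i. forward lay s W i u * W i u v)"

lemma separable_forward:
  fixes W :: "nat \<Rightarrow> 'u \<Rightarrow> 'u \<Rightarrow> 'e \<Rightarrow> 'e \<Rightarrow> 'b::comm_semiring_1"
  assumes lay: "\<And>i. i \<le> N \<Longrightarrow> finite (lay i) \<and> card (lay i) \<le> r" and "1 \<le> r"
    and "finite T" and T: "\<And>i. col (Suc i) \<noteq> col i \<Longrightarrow> Suc i \<in> T"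
    and W: "\<And>i. i < N \<Longrightarrow> separable_by (col i) (D i) (lay i \<times> lay (Suc i)) (\<lambda>(u, v). W i u v)"
  shows "i \<le> N \<Longrightarrow> separable_by (col i) (r ^ card (T \<inter> {1..i}) * (\<Prod>j<i. D j)) (lay i)
    (\<lambda>v e e'. forward lay s (\<lambda>i u v. W i u v e e') i v)"
proof (induction i)
  case 0
  show ?case
    by (simp add: separable_by_def separable_fst[of _ _ "\<lambda>v _. if v = s then 1 else 0", simplified])
next
  case (Suc i)
  let ?R = "r ^ card (T \<inter> {1..i}) * (\<Prod>j<i. D j)"
  let ?F = "\<lambda>i v e e'. forward lay s (\<lambda>i u v. W i u v e e') i v"
  have IH: "separable_by (col i) ?R (lay i) (?F i)" and i: "i < N"
    using Suc by auto
  have step: "separable_by (col i) (?R * D i) (lay (Suc i)) (?F (Suc i))"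
    using separable_step[of ?R "lay i" _ "D i" "lay (Suc i)"] IH W[OF i]
    by (auto simp: separable_by_def case_prod_unfold)
  have "card (T \<inter> {1..i}) \<le> card (T \<inter> {1..Suc i})"
    using assms(3) by (intro card_mono) auto
  then have le: "?R * D i \<le> r ^ card (T \<inter> {1..Suc i}) * (\<Prod>j<Suc i. D j)"
    using \<open>1 \<le> r\<close> by (simp add: power_increasing)
  show ?case
  proof (cases "col (Suc i) = col i")
    case True
    then show ?thesis
      using step separable_mono[OF _ le] by (auto simp: separable_by_def)
  next
    case False
    then have "T \<inter> {1..Suc i} = insert (Suc i) (T \<inter> {1..i})"
      using T by auto
    then have eq: "?R * D i * r = r ^ card (T \<inter> {1..Suc i}) * (\<Prod>j<Suc i. D j)"
      using assms(3) by simp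
    have "separable_by (col (Suc i)) (?R * D i * r) (lay (Suc i)) (?F (Suc i))"
      using False step lay[of "Suc i"] Suc.prems separable_swap[of "?R * D i" "lay (Suc i)" _ r]
      unfolding separable_by_def by (auto split: if_splits)
    then show ?thesis
      by (simp only: eq)
  qed
qed

lemma sum_st_paths_eq_forward:
  fixes B :: "('x, 'v, 'a::zero) roabp" and w :: "nat \<Rightarrow> 'v \<Rightarrow> 'v \<Rightarrow> 'b::comm_semiring_1"
  assumes "is_roabp V r d B" "layer B 0 = {s}" "layer B (num_vars B) = {t}"
  shows "(\<Sum>p\<in>st_paths B. \<Prod>i<num_vars B. w i (p ! i) (p ! Suc i)) =
    forward (layer B) s (\<lambda>i u v. if (u, v) \<in> edges B then w i u v else 0) (num_vars B) t"
proof -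
  define N where "N = num_vars B"
  define W where "W i u v = (if (u, v) \<in> edges B then w i u v else 0)" for i u v
  define P where "P i v = {p. length p = Suc i \<and> p ! 0 \<in> layer B 0 \<and> p ! i = v \<and>
    (\<forall>j<i. (p ! j, p ! Suc j) \<in> edges B)}" for i v
  have fin: "finite (layer B i)" if "i \<le> N" for i
    using assms(1) that by (auto simp: is_roabp_def N_def)
  have edge: "u \<in> layer B i" if uv: "(u, v) \<in> edges B" and v: "v \<in> layer B (Suc i)" and i: "i < N" for u v i
  proof -
    obtain k where k: "k < N" "u \<in> layer B k" "v \<in> layer B (Suc k)"
      using uv assms(1) by (auto simp: is_roabp_def N_def)
    have "disjoint_family_on (layer B) {..N}"
      using assms(1) by (simp add: is_roabp_def N_def)
    then have "Suc i = Suc k"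
      using k v i unfolding disjoint_family_on_def
      by (metis IntI Suc_leI atMost_iff empty_iff)
    then show ?thesis using k by simp
  qed
  have step: "P (Suc i) v =
      (\<lambda>(u, p). p @ [v]) ` (SIGMA u:{u \<in> layer B i. (u, v) \<in> edges B}. P i u)"
    if "v \<in> layer B (Suc i)" "i < N" for i v
  proof (intro equalityI subsetI)
    fix p assume p: "p \<in> P (Suc i) v"
    then have "p \<noteq> []" by (auto simp: P_def)
    then have app: "p = butlast p @ [v]"
      using p append_butlast_last_id[of p] by (simp add: P_def last_conv_nth)
    have len: "length (butlast p) = Suc i"
      using p by (simp add: P_def)
    have nth: "butlast p ! j = p ! j" if "j \<le> i" for j
      using that len by (simp add: nth_butlast)
    have e: "(p ! i, v) \<in> edges B"
      using p by (auto simp: P_def)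
    then have "p ! i \<in> layer B i"
      using edge that by blast
    moreover have "butlast p \<in> P i (p ! i)"
      using p len nth by (auto simp: P_def)
    ultimately show "p \<in> (\<lambda>(u, p). p @ [v]) ` (SIGMA u:{u \<in> layer B i. (u, v) \<in> edges B}. P i u)"
      using e app by (intro image_eqI[of _ _ "(p ! i, butlast p)"]) auto
  next
    fix p assume "p \<in> (\<lambda>(u, p). p @ [v]) ` (SIGMA u:{u \<in> layer B i. (u, v) \<in> edges B}. P i u)"
    then show "p \<in> P (Suc i) v"
      by (auto simp: P_def nth_append less_Suc_eq)
  qed
  have main: "finite (P i v) \<and> (\<Sum>p\<in>P i v. \<Prod>j<i. w j (p ! j) (p ! Suc j)) = forward (layer B) s W i v"
    if "v \<in> layer B i" "i \<le> N" for i v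
    using that
  proof (induction i arbitrary: v)
    case 0
    then have v: "v = s"
      using assms(2) by simp
    have "P 0 s = {[s]}"
      unfolding P_def assms(2) by (auto simp: length_Suc_conv)
    then show ?case
      by (simp add: v)
  next
    case (Suc i)
    let ?U = "{u \<in> layer B i. (u, v) \<in> edges B}"
    have i: "i < N" using Suc.prems by simp
    have fin_U: "finite ?U" using fin[of i] i by simp
    have fin_P: "\<forall>u\<in>?U. finite (P i u)" using Suc.IH i by auto
    have inj: "inj_on (\<lambda>(u, p). p @ [v]) (SIGMA u:?U. P i u)"
      by (auto simp: inj_on_def P_def)
    have "(\<Sum>p\<in>P (Suc i) v. \<Prod>j<Suc i. w j (p ! j) (p ! Suc j)) =
        (\<Sum>(u, p)\<in>(SIGMA u:?U. P i u). \<Prod>j<Suc i. w j ((p @ [v]) ! j) ((p @ [v]) ! Suc j))"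
      unfolding step[OF Suc.prems(1) i]
      by (subst sum.reindex[OF inj]) (simp add: case_prod_unfold)
    also have "\<dots> = (\<Sum>(u, p)\<in>(SIGMA u:?U. P i u). (\<Prod>j<i. w j (p ! j) (p ! Suc j)) * w i u v)"
    proof (rule sum.cong[OF refl], clarify)
      fix u p assume "p \<in> P i u"
      then have p: "length p = Suc i" "p ! i = u" by (auto simp: P_def)
      have "(\<Prod>j<i. w j ((p @ [v]) ! j) ((p @ [v]) ! Suc j)) = (\<Prod>j<i. w j (p ! j) (p ! Suc j))"
        using p by (intro prod.cong) (auto simp: nth_append)
      then show "(\<Prod>j<Suc i. w j ((p @ [v]) ! j) ((p @ [v]) ! Suc j)) =
          (\<Prod>j<i. w j (p ! j) (p ! Suc j)) * w i u v"
        using p by (simp add: nth_append)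
    qed
    also have "\<dots> = (\<Sum>u\<in>?U. (\<Sum>p\<in>P i u. \<Prod>j<i. w j (p ! j) (p ! Suc j)) * w i u v)"
      using fin_U fin_P by (simp add: sum.Sigma[symmetric] sum_distrib_right)
    also have "\<dots> = (\<Sum>u\<in>?U. forward (layer B) s W i u * w i u v)"
      using Suc.IH i by (intro sum.cong) auto
    also have "\<dots> = (\<Sum>u\<in>layer B i. forward (layer B) s W i u * W i u v)"
      by (rule sum.mono_neutral_cong_left) (use fin[of i] i in \<open>auto simp: W_def\<close>)
    finally have "(\<Sum>p\<in>P (Suc i) v. \<Prod>j<Suc i. w j (p ! j) (p ! Suc j)) = forward (layer B) s W (Suc i) v"
      by simp
    moreover have "finite (P (Suc i) v)"
      unfolding step[OF Suc.prems(1) i] using fin_U fin_P by (intro finite_imageI finite_SigmaI) auto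
    ultimately show ?case by blast
  qed
  have "st_paths B = P N t"
    using assms(3) by (auto simp: st_paths_def P_def N_def)
  then show ?thesis
    using main[of t N] assms(3) by (simp add: N_def W_def[abs_def])
qed

section \<open>The lower bound\<close>

fun ips_assignment :: "(nat \<Rightarrow> 'b::comm_ring_1) \<Rightarrow> 'b \<Rightarrow> ips_var \<Rightarrow> 'b" where
  "ips_assignment \<sigma> z (XVar i) = \<sigma> i"
| "ips_assignment \<sigma> z YVar = 0"
| "ips_assignment \<sigma> z ZVar = z"
| "ips_assignment \<sigma> z (WVar i) = \<sigma> i ^ 2 - \<sigma> i"

lemma poly_map_poly_add:
  fixes a b :: "'b::comm_ring_1"
  assumes "h 0 = 0" "degree q \<le> d"
  shows "poly (map_poly h q) (a + b) =
    (\<Sum>j<Suc d. (\<Sum>k\<le>d. h (coeff q k) * of_nat (k choose j) * a ^ (k - j)) * b ^ j)"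
proof -
  have binom: "(a + b) ^ k = (\<Sum>j<Suc d. of_nat (k choose j) * a ^ (k - j) * b ^ j)" if "k \<le> d" for k
  proof -
    have "(a + b) ^ k = (\<Sum>j\<le>k. of_nat (k choose j) * b ^ j * a ^ (k - j))"
      using binomial_ring[of b a k] by (simp add: add.commute)
    also have "\<dots> = (\<Sum>j<Suc d. of_nat (k choose j) * a ^ (k - j) * b ^ j)"
      by (rule sum.mono_neutral_cong_left) (use that in \<open>auto simp: mult_ac binomial_eq_0 intro!: leI\<close>)
    finally show ?thesis .
  qed
  have "poly (map_poly h q) (a + b) =
      (\<Sum>k\<le>d. \<Sum>j<Suc d. h (coeff q k) * of_nat (k choose j) * a ^ (k - j) * b ^ j)"
    unfolding poly_map_poly_sum[of h, OF assms]
    by (intro sum.cong refl) (simp only: binom atMost_iff sum_distrib_left mult.assoc)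
  also have "\<dots> = (\<Sum>j<Suc d. \<Sum>k\<le>d. h (coeff q k) * of_nat (k choose j) * a ^ (k - j) * b ^ j)"
    by (rule sum.swap)
  finally show ?thesis
    by (simp only: sum_distrib_right)
qed

context coeff_hom
begin

lemma refutation_eval_zero:
  assumes "ips_refutation n f g C"
  shows "mpoly_eval h (ips_assignment (\<lambda>_. 1) 0) C = 0"
proof -
  have "mpoly_eval h (\<lambda>_. 1) (ips_zero_subst v) = ips_assignment (\<lambda>_. 1) 0 v" for v
    by (cases v) simp_all
  then show ?thesis
    using assms eval_subst[of "\<lambda>_. 1" ips_zero_subst C] by (simp add: ips_refutation_def)
qed

lemma refutation_eval_one:
  assumes "ips_refutation n f g C" "mpoly_eval h \<sigma> f = 0"
  shows "mpoly_eval h (ips_assignment \<sigma> (mpoly_eval h \<sigma> g)) C = 1"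
proof -
  have "mpoly_eval h \<sigma> (ips_axiom_subst f g v) = ips_assignment \<sigma> (mpoly_eval h \<sigma> g) v" for v
    by (cases v) (simp_all add: assms(2) eval_bool_axiom)
  then show ?thesis
    using assms(1) eval_subst[of \<sigma> "ips_axiom_subst f g" C] by (simp add: ips_refutation_def)
qed

definition residual :: "nat \<Rightarrow> (ips_var, 'a) mpoly \<Rightarrow> (nat \<Rightarrow> 'b) \<Rightarrow> 'b" where
  "residual n C \<sigma> = 1 - mpoly_eval h (ips_assignment \<sigma> ((\<Sum>i\<in>{1..n}. \<sigma> i) - of_nat n)) C"

lemma residual_ones:
  assumes "ips_refutation n f g C"
  shows "residual n C (\<lambda>_. 1) = 1"
  using refutation_eval_zero[OF assms] by (simp add: residual_def)

lemma residual_eq_0: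
  assumes "ips_refutation n (hard_f n) (hard_g n) C"
    and "i \<in> {1..n}" "j \<in> {1..n}" "i \<noteq> j" "\<sigma> i + \<sigma> j = 1"
  shows "residual n C \<sigma> = 0"
  using refutation_eval_one[OF assms(1) eval_hard_f_eq_0[OF assms(2-5)]]
  by (simp add: residual_def eval_hard_g)

lemma line_poly_residual:
  assumes "\<And>k. line_poly (\<lambda>\<sigma>. s \<sigma> k)"
  shows "line_poly (\<lambda>\<sigma>. residual n C (s \<sigma>))"
proof -
  have "line_poly (\<lambda>\<sigma>. ips_assignment (s \<sigma>) ((\<Sum>i\<in>{1..n}. s \<sigma> i) - of_nat n) v)" for v
    by (cases v) (auto intro!: line_poly_diff line_poly_sum line_poly_power assms)
  then show ?thesis
    unfolding residual_def by (intro line_poly_diff line_poly_const line_poly_mpoly_eval)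
qed

text \<open>Each index \<open>a\<close> carries two generic values, \<open>\<rho> a\<close> and \<open>\<rho> (\<pi> a)\<close>. The set \<open>e\<close> decides which of
  them is given to \<open>x\<^sub>a\<close>, and \<open>1 - x\<close> for \<open>\<pi> a\<close> takes the one that \<open>e'\<close> does not choose. If \<open>e\<close> and \<open>e'\<close>
  differ at \<open>a\<close>, both are the same value and the factor of \<open>f\<close> for the pair vanishes.\<close>

lemma residual_diagonal:
  assumes ref: "ips_refutation n (hard_f n) (hard_g n) C"
    and inf: "infinite (UNIV :: 'b set)"
    and A: "A \<subseteq> {1..n}" and D: "D \<subseteq> {1..n}" and disj: "A \<inter> D = {}" and card: "card A = card D"
  obtains \<alpha> \<beta> :: "nat set \<Rightarrow> nat \<Rightarrow> 'b" where
    "\<And>e k. k \<notin> A \<Longrightarrow> \<alpha> e k = \<alpha> {} k"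
    "\<And>e e'. e \<subseteq> A \<Longrightarrow> e' \<subseteq> A \<Longrightarrow>
       residual n C (\<lambda>k. if k \<in> D then \<beta> e' k else \<alpha> e k) = 0 \<longleftrightarrow> e \<noteq> e'"
proof -
  have fin: "finite A" "finite D"
    using A D finite_subset by blast+
  obtain \<pi> where \<pi>: "bij_betw \<pi> A D"
    using finite_same_card_bij[OF fin card] by blast
  define \<pi>' where "\<pi>' = inv_into A \<pi>"
  have \<pi>_in: "\<pi> a \<in> D" "\<pi>' (\<pi> a) = a" "\<pi> a \<noteq> a" "\<pi> a \<notin> A" "a \<notin> D" if "a \<in> A" for a
  proof -
    show 1: "\<pi> a \<in> D" using bij_betwE[OF \<pi>] that by blast
    show "\<pi>' (\<pi> a) = a" using \<pi> that by (simp add: \<pi>'_def bij_betw_def)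
    show "\<pi> a \<notin> A" "a \<notin> D" using 1 that disj by blast+
    then show "\<pi> a \<noteq> a" using that by metis
  qed
  have \<pi>'_in: "\<pi>' k \<in> A" "\<pi> (\<pi>' k) = k" if "k \<in> D" for k
    using \<pi> that unfolding \<pi>'_def bij_betw_def by (auto simp: inv_into_into f_inv_into_f)
  define \<alpha> where "\<alpha> \<rho> e k = (if k \<in> A \<and> k \<notin> e then \<rho> (\<pi> k) else \<rho> k)" for \<rho> :: "nat \<Rightarrow> 'b" and e k
  define \<beta> where "\<beta> \<rho> e k = 1 - (if \<pi>' k \<in> e then \<rho> k else \<rho> (\<pi>' k))" for \<rho> :: "nat \<Rightarrow> 'b" and e k
  define pt where "pt \<rho> e e' k = (if k \<in> D then \<beta> \<rho> e' k else \<alpha> \<rho> e k)" for \<rho> e e' k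
  have "\<exists>\<rho>. \<forall>e\<in>Pow A. residual n C (pt \<rho> e e) \<noteq> 0"
  proof (rule line_poly_common_nonzero[OF inf])
    show "finite (Pow A)" using fin by simp
  next
    fix e
    have "line_poly (\<lambda>\<rho>. pt \<rho> e e k)" for k
      unfolding pt_def \<alpha>_def \<beta>_def
      by (cases "k \<in> D"; cases "\<pi>' k \<in> e"; cases "k \<in> A \<and> k \<notin> e")
        (auto intro!: line_poly_diff)
    then show "line_poly (\<lambda>\<rho>. residual n C (pt \<rho> e e))"
      by (rule line_poly_residual)
  next
    fix e assume "e \<in> Pow A"
    define \<rho> :: "nat \<Rightarrow> 'b" where
      "\<rho> k = (if k \<in> A \<and> k \<notin> e \<or> k \<in> D \<and> \<pi>' k \<in> e then 0 else 1)" for k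
    have "pt \<rho> e e k = 1" for k
    proof -
      consider "k \<in> D" | "k \<in> A" "k \<notin> D" | "k \<notin> A" "k \<notin> D" by blast
      then show ?thesis
      proof cases
        case 1
        then show ?thesis
          using \<pi>'_in[of k] \<pi>_in(5)[of k] \<pi>_in(5)[of "\<pi>' k"] by (simp add: pt_def \<beta>_def \<rho>_def)
      next
        case 2
        then show ?thesis
          using \<pi>_in[of k] by (simp add: pt_def \<alpha>_def \<rho>_def)
      next
        case 3
        then show ?thesis
          by (simp add: pt_def \<alpha>_def \<rho>_def)
      qed
    qed
    then have "pt \<rho> e e = (\<lambda>_. 1)"
      by blast
    then show "\<exists>\<rho>. residual n C (pt \<rho> e e) \<noteq> 0"
      using residual_ones[OF ref] by (intro exI[of _ \<rho>]) simp
  qed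
  then obtain \<rho> where \<rho>: "\<And>e. e \<subseteq> A \<Longrightarrow> residual n C (pt \<rho> e e) \<noteq> 0"
    by blast
  show thesis
  proof (rule that[of "\<alpha> \<rho>" "\<beta> \<rho>"])
    show "\<alpha> \<rho> e k = \<alpha> \<rho> {} k" if "k \<notin> A" for e k
      using that by (simp add: \<alpha>_def)
  next
    fix e e' assume e: "e \<subseteq> A" "e' \<subseteq> A"
    have "residual n C (pt \<rho> e e') = 0" if "e \<noteq> e'"
    proof -
      obtain a where a: "a \<in> A" "(a \<in> e) \<noteq> (a \<in> e')"
        using e \<open>e \<noteq> e'\<close> by blast
      have "pt \<rho> e e' a + pt \<rho> e e' (\<pi> a) = 1"
        using a \<pi>_in[OF a(1)] by (cases "a \<in> e") (simp_all add: pt_def \<alpha>_def \<beta>_def)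
      then show ?thesis
        using a(1) \<pi>_in[OF a(1)] A D by (intro residual_eq_0[OF ref, of a "\<pi> a"]) auto
    qed
    then have "residual n C (pt \<rho> e e') = 0 \<longleftrightarrow> e \<noteq> e'"
      using \<rho> e by blast
    then show "residual n C (\<lambda>k. if k \<in> D then \<beta> \<rho> e' k else \<alpha> \<rho> e k) = 0 \<longleftrightarrow> e \<noteq> e'"
      by (simp only: pt_def[abs_def])
  qed
qed

lemma eval_roabp_poly:
  assumes "is_roabp V r d B" "layer B 0 = {s}" "layer B (num_vars B) = {t}"
  shows "mpoly_eval h \<sigma> (roabp_poly B) =
    forward (layer B) s
      (\<lambda>i u v. if (u, v) \<in> edges B then poly (map_poly h (label B (u, v))) (\<sigma> (var_order B ! i)) else 0)
      (num_vars B) t"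
  unfolding roabp_poly_def eval_sum eval_prod eval_univ_in
  by (rule sum_st_paths_eq_forward[OF assms])

lemma refutation_degree_pos:
  fixes B :: "(ips_var, 'v, 'a) roabp"
  assumes "roabp_ips_refutation n f g r d B"
  shows "1 \<le> d"
proof (rule ccontr)
  assume d: "\<not> 1 \<le> d"
  have B: "is_roabp (ips_vars n) r d B" and ref: "ips_refutation n f g (roabp_poly B)"
    using assms by (auto simp: roabp_ips_refutation_def)
  obtain s t where st: "layer B 0 = {s}" "layer B (num_vars B) = {t}"
    using B by (auto simp: is_roabp_def)
  have "poly (map_poly h (label B e)) x = h (coeff (label B e) 0)" if "e \<in> edges B" for e x
    using B that d by (subst poly_map_poly_sum[where d = 0]) (auto simp: is_roabp_def)
  then have "mpoly_eval h \<sigma> (roabp_poly B) = mpoly_eval h \<tau> (roabp_poly B)" for \<sigma> \<tau>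
    unfolding eval_roabp_poly[OF B st] by (simp cong: if_cong)
  then have "mpoly_eval h (\<lambda>_. 0) (mpoly_subst ips_zero_subst (roabp_poly B)) =
      mpoly_eval h (\<lambda>_. 0) (mpoly_subst (ips_axiom_subst f g) (roabp_poly B))"
    unfolding eval_subst by blast
  then show False
    using ref by (simp add: ips_refutation_def)
qed

lemma roabp_residual_rank:
  fixes B :: "(ips_var, 'v, 'a) roabp" and \<alpha> \<beta> :: "nat set \<Rightarrow> nat \<Rightarrow> 'b"
  assumes B: "is_roabp (ips_vars n) r d B"
    and T: "finite T" "card T \<le> 4"
    and pos: "\<And>k. k \<in> {1..n} \<Longrightarrow> p k < num_vars B \<and> var_order B ! p k = XVar k"
      "\<And>k. k \<in> {1..n} \<Longrightarrow> q k < num_vars B \<and> var_order B ! q k = WVar k"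
    and AD: "A \<subseteq> {1..n}" "D \<subseteq> {1..n}"
    and sep: "\<forall>\<phi>\<in>{p, q}. \<forall>\<psi>\<in>{p, q}. \<forall>a\<in>A. \<forall>b\<in>D. \<exists>t\<in>T. (\<phi> a < t) \<noteq> (\<psi> b < t)"
    and \<alpha>: "\<And>e k. k \<notin> A \<Longrightarrow> \<alpha> e k = \<alpha> {} k"
  shows "\<exists>x y. \<forall>e e'. residual n (roabp_poly B) (\<lambda>k. if k \<in> D then \<beta> e' k else \<alpha> e k) =
    (\<Sum>k<Suc (r ^ 4 * Suc d). x k e * y k e')"
proof -
  define N where "N = num_vars B"
  obtain s t where st: "layer B 0 = {s}" "layer B (num_vars B) = {t}"
    using B by (auto simp: is_roabp_def)
  have lay: "finite (layer B i) \<and> card (layer B i) \<le> r" if "i \<le> N" for i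
    using B that by (auto simp: is_roabp_def N_def)
  have r: "1 \<le> r"
    using lay[of 0] st(1) by simp
  \<comment> \<open>The thresholds in \<open>T\<close> cut the variable order into intervals, none of which contains positions
    of both \<open>A\<close> and \<open>D\<close>; \<open>col\<close> marks the intervals of \<open>A\<close>.\<close>
  define col where "col i \<longleftrightarrow> (\<exists>a\<in>A. \<exists>\<phi>\<in>{p, q}. \<forall>t\<in>T. (\<phi> a < t) = (i < t))" for i
  have col_step: "Suc i \<in> T" if "col (Suc i) \<noteq> col i" for i
  proof (rule ccontr)
    assume "Suc i \<notin> T"
    then have "\<forall>t\<in>T. (Suc i < t) = (i < t)"
      by (metis Suc_lessI Suc_lessD)
    then show False using that by (auto simp: col_def)
  qed
  have dist: "distinct (var_order B)" and vars: "set (var_order B) = ips_vars n"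
    using B by (auto simp: is_roabp_def)
  have pos_eq: "i = p k" if "i < N" "var_order B ! i = XVar k" for i k
  proof -
    have "XVar k \<in> ips_vars n"
      using that vars nth_mem[of i "var_order B"] by (simp add: N_def num_vars_def)
    then have "k \<in> {1..n}" by (auto simp: ips_vars_def)
    then show ?thesis
      using pos(1)[of k] that dist nth_eq_iff_index_eq[of "var_order B" i "p k"]
      by (simp add: N_def num_vars_def)
  qed
  have pos_eq': "i = q k" if "i < N" "var_order B ! i = WVar k" for i k
  proof -
    have "WVar k \<in> ips_vars n"
      using that vars nth_mem[of i "var_order B"] by (simp add: N_def num_vars_def)
    then have "k \<in> {1..n}" by (auto simp: ips_vars_def)
    then show ?thesis
      using pos(2)[of k] that dist nth_eq_iff_index_eq[of "var_order B" i "q k"]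
      by (simp add: N_def num_vars_def)
  qed
  have col_A: "col (p k)" "col (q k)" if "k \<in> A" for k
    using that unfolding col_def by blast+
  have col_D: "\<not> col (p k)" "\<not> col (q k)" if "k \<in> D" for k
    using that sep unfolding col_def by blast+
  have at: "i = p k \<or> i = q k" if "i < N" "var_order B ! i \<in> {XVar k, WVar k}" for i k
    using that pos_eq[of i k] pos_eq'[of i k] by blast
  define pt where "pt e e' k = (if k \<in> D then \<beta> e' k else \<alpha> e k)" for e e' k
  have pt_T: "pt e e' k = pt e {} k"
    if "i < N" "col i" "var_order B ! i \<in> {XVar k, WVar k}" for i k e e'
  proof -
    have "k \<notin> D" using at[OF that(1,3)] that(2) col_D[of k] by blast
    then show ?thesis by (simp add: pt_def)
  qed
  have pt_F: "pt e e' k = pt {} e' k"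
    if "i < N" "\<not> col i" "var_order B ! i \<in> {XVar k, WVar k}" for i k e e'
  proof -
    have "k \<notin> A" using at[OF that(1,3)] that(2) col_A[of k] by blast
    then show ?thesis using \<alpha>[of k e] by (simp add: pt_def)
  qed
  define g1 where "g1 e = (\<Sum>k\<in>{1..n} - D. \<alpha> e k) - of_nat n" for e
  define g2 where "g2 e = (\<Sum>k\<in>D. \<beta> e k)" for e
  define asg where "asg e e' = ips_assignment (pt e e') (g1 e + g2 e')" for e e'
  have g: "(\<Sum>k\<in>{1..n}. pt e e' k) - of_nat n = g1 e + g2 e'" for e e'
  proof -
    have "(\<Sum>k\<in>{1..n}. pt e e' k) = (\<Sum>k\<in>{1..n} - D. pt e e' k) + (\<Sum>k\<in>D. pt e e' k)"
      using AD(2) by (intro sum.subset_diff) auto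
    then show ?thesis
      by (simp add: g1_def g2_def pt_def)
  qed
  define W where "W i u v e e' =
    (if (u, v) \<in> edges B then poly (map_poly h (label B (u, v))) (asg e e' (var_order B ! i)) else 0)"
    for i u v e e'
  define R where "R i = (if var_order B ! i = ZVar then Suc d else 1)" for i
  have W_sep: "separable_by (col i) (R i) (layer B i \<times> layer B (Suc i)) (\<lambda>(u, v). W i u v)"
    if i: "i < N" for i
  proof (cases "var_order B ! i = ZVar")
    case True
    have deg: "degree (label B e) \<le> d" if "e \<in> edges B" for e
      using B that by (auto simp: is_roabp_def)
    let ?c = "\<lambda>a k e. if e \<in> edges B then
      (\<Sum>j\<le>d. h (coeff (label B e) j) * of_nat (j choose k) * a ^ (j - k)) else 0"
    have poly_add: "W i u v e e' = (\<Sum>k<Suc d. ?c (g1 e) k (u, v) * g2 e' ^ k)"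
      "W i u v e e' = (\<Sum>k<Suc d. ?c (g2 e') k (u, v) * g1 e ^ k)" for u v e e'
      using poly_map_poly_add[of h "label B (u, v)" d "g1 e" "g2 e'"]
        poly_map_poly_add[of h "label B (u, v)" d "g2 e'" "g1 e"] deg[of "(u, v)"]
      by (simp_all add: W_def asg_def True add.commute)
    have "separable (Suc d) (layer B i \<times> layer B (Suc i)) (\<lambda>(u, v). W i u v)"
      by (rule separableI[where x = "\<lambda>k u e. ?c (g1 e) k u" and y = "\<lambda>k e'. g2 e' ^ k"])
        (clarsimp simp only: poly_add(1) split_paired_all prod.case)
    moreover have "separable (Suc d) (layer B i \<times> layer B (Suc i)) (\<lambda>u e' e. (\<lambda>(u, v). W i u v) u e e')"
      by (rule separableI[where x = "\<lambda>k u e. ?c (g2 e) k u" and y = "\<lambda>k e'. g1 e' ^ k"])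
        (clarsimp simp only: poly_add(2) split_paired_all prod.case)
    ultimately show ?thesis
      by (simp add: separable_by_def R_def True)
  next
    case False
    have asg_T: "asg e e' (var_order B ! i) = asg e {} (var_order B ! i)" if "col i" for e e'
      using pt_T[OF i that, of _ e e'] False by (cases "var_order B ! i") (simp_all add: asg_def)
    have asg_F: "asg e e' (var_order B ! i) = asg {} e' (var_order B ! i)" if "\<not> col i" for e e'
      using pt_F[OF i that, of _ e e'] False by (cases "var_order B ! i") (simp_all add: asg_def)
    show ?thesis
    proof (cases "col i")
      case True
      have eq: "W i u v e e' = W i u v e {}" for u v e e'
        using asg_T[OF True, of e e'] by (simp add: W_def)
      have "separable 1 (layer B i \<times> layer B (Suc i)) (\<lambda>(u, v). W i u v)"
        by (rule separable_fst[where x = "\<lambda>(u, v) e. W i u v e {}"])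
          (simp only: split_paired_all prod.case, rule eq)
      then show ?thesis
        using True False by (simp add: separable_by_def R_def)
    next
      case False': False
      have eq: "W i u v e e' = W i u v {} e'" for u v e e'
        using asg_F[OF False', of e e'] by (simp add: W_def)
      have "separable 1 (layer B i \<times> layer B (Suc i)) (\<lambda>u e' e. (\<lambda>(u, v). W i u v) u e e')"
        by (rule separable_fst[where x = "\<lambda>(u, v) e'. W i u v {} e'"])
          (simp only: split_paired_all prod.case, rule eq)
      then show ?thesis
        using False' False by (simp add: separable_by_def R_def)
    qed
  qed
  define M where "M = r ^ 4 * Suc d"
  have "ZVar \<in> set (var_order B)"
    by (simp add: vars ips_vars_def)
  then obtain z where z: "z < N" "var_order B ! z = ZVar"
    by (auto simp: in_set_conv_nth N_def num_vars_def)
  have "var_order B ! j = ZVar \<longleftrightarrow> j = z" if "j < N" for j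
    using nth_eq_iff_index_eq[OF dist, of j z] that z by (simp add: N_def num_vars_def)
  then have "(\<Prod>j<N. R j) = (\<Prod>j<N. if j = z then Suc d else 1)"
    by (intro prod.cong) (simp_all add: R_def)
  also have "\<dots> = Suc d"
    using z(1) by simp
  finally have prod: "(\<Prod>j<N. R j) = Suc d" .
  have "card (T \<inter> {1..N}) \<le> 4"
    using T card_mono[of T "T \<inter> {1..N}"] by simp
  then have le: "r ^ card (T \<inter> {1..N}) * Suc d \<le> M"
    using r unfolding M_def by (intro mult_right_mono power_increasing) auto
  have "separable_by (col N) (r ^ card (T \<inter> {1..N}) * Suc d) (layer B N)
      (\<lambda>v e e'. forward (layer B) s (\<lambda>i u v. W i u v e e') N v)"
    using separable_forward[of N "layer B" r T col R W N s, OF lay r T(1) col_step W_sep] prod by simp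
  then have sepM: "separable_by (col N) M (layer B N)
      (\<lambda>v e e'. forward (layer B) s (\<lambda>i u v. W i u v e e') N v)"
    using separable_mono[OF _ le] by (auto simp: separable_by_def)
  have fwd: "forward (layer B) s (\<lambda>i u v. W i u v e e') N t = mpoly_eval h (asg e e') (roabp_poly B)" for e e'
    unfolding eval_roabp_poly[OF B st] W_def N_def ..
  have "\<exists>x y. \<forall>e e'. mpoly_eval h (asg e e') (roabp_poly B) = (\<Sum>k<M. x k e * y k e')"
  proof (cases "col N")
    case True
    then obtain x y where "\<forall>e e'. forward (layer B) s (\<lambda>i u v. W i u v e e') N t = (\<Sum>k<M. x k t e * y k e')"
      using sepM st(2) by (auto simp: separable_by_def separable_def N_def)
    then show ?thesis
      by (intro exI[of _ "\<lambda>k. x k t"] exI[of _ y]) (simp add: fwd)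
  next
    case False
    then obtain x y where "\<forall>e' e. forward (layer B) s (\<lambda>i u v. W i u v e e') N t = (\<Sum>k<M. x k t e' * y k e)"
      using sepM st(2) by (auto simp: separable_by_def separable_def N_def)
    then show ?thesis
      by (intro exI[of _ y] exI[of _ "\<lambda>k. x k t"]) (simp add: fwd mult.commute)
  qed
  then obtain x y where xy: "\<And>e e'. mpoly_eval h (asg e e') (roabp_poly B) = (\<Sum>k<M. x k e * y k e')"
    by blast
  have "residual n (roabp_poly B) (pt e e') =
      (\<Sum>k<Suc M. (if k = M then 1 else - x k e) * (if k = M then 1 else y k e'))" for e e'
    unfolding residual_def g xy[unfolded asg_def] by (simp add: sum_negf)
  then show ?thesis
    unfolding pt_def[abs_def] M_def
    by (intro exI[of _ "\<lambda>k e. if k = r ^ 4 * Suc d then 1 else - x k e"]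
        exI[of _ "\<lambda>k e'. if k = r ^ 4 * Suc d then 1 else y k e'"]) blast
qed

end

lemma infinite_UNIV_poly: "infinite (UNIV :: 'a::comm_ring_1 poly set)"
proof -
  have "inj (\<lambda>k. monom (1::'a) k)"
    by (auto simp: inj_def monom_eq_iff')
  then show ?thesis
    using range_inj_infinite finite_subset[OF subset_UNIV] by blast
qed

lemma refutation_rank:
  fixes B :: "(ips_var, 'v, 'a::field) roabp"
  assumes "roabp_ips_refutation n (hard_f n) (hard_g n) r d B"
  shows "1 \<le> d \<and> 2 ^ (n div 32) \<le> Suc (r ^ 4 * Suc d)"
proof -
  have hom: "coeff_hom (\<lambda>c::'a. [:c:])"
    by unfold_locales (simp_all add: one_pCons)
  have B: "is_roabp (ips_vars n) r d B"
    and ref: "ips_refutation n (hard_f n) (hard_g n) (roabp_poly B)"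
    using assms by (auto simp: roabp_ips_refutation_def)
  have "\<exists>i<num_vars B. var_order B ! i = v" if "v \<in> ips_vars n" for v
    using B that by (auto simp: is_roabp_def num_vars_def in_set_conv_nth[symmetric])
  then obtain idx where idx: "\<And>v. v \<in> ips_vars n \<Longrightarrow> idx v < num_vars B \<and> var_order B ! idx v = v"
    by metis
  define p where "p k = idx (XVar k)" for k
  define q where "q k = idx (WVar k)" for k
  have pos: "p k < num_vars B \<and> var_order B ! p k = XVar k" "q k < num_vars B \<and> var_order B ! q k = WVar k"
    if "k \<in> {1..n}" for k
    using that by (simp_all add: p_def q_def idx ips_vars_def)
  have inj: "inj_on p {1..n}" "inj_on q {1..n}"
    using pos by (metis inj_onI ips_var.inject)+
  have "32 * (n div 32) \<le> card {1..n}"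
    by simp
  then obtain A D T where AD: "A \<subseteq> {1..n}" "D \<subseteq> {1..n}" "A \<inter> D = {}" "card A = n div 32" "card D = n div 32"
    and T: "finite T" "card T \<le> 4"
    and sep: "\<forall>\<phi>\<in>{p, q}. \<forall>\<psi>\<in>{p, q}. \<forall>a\<in>A. \<forall>b\<in>D. \<exists>t\<in>T. (\<phi> a < t) \<noteq> (\<psi> b < t)"
    by (rule separated_subsets[OF finite_atLeastAtMost inj])
  have card: "card A = card D"
    using AD(4,5) by simp
  obtain \<alpha> \<beta> :: "nat set \<Rightarrow> nat \<Rightarrow> 'a poly" where \<alpha>: "\<And>e k. k \<notin> A \<Longrightarrow> \<alpha> e k = \<alpha> {} k"
    and diag: "\<And>e e'. e \<subseteq> A \<Longrightarrow> e' \<subseteq> A \<Longrightarrow>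
       coeff_hom.residual (\<lambda>c. [:c:]) n (roabp_poly B) (\<lambda>k. if k \<in> D then \<beta> e' k else \<alpha> e k) = 0 \<longleftrightarrow> e \<noteq> e'"
    by (rule coeff_hom.residual_diagonal[OF hom ref infinite_UNIV_poly AD(1-3) card], rule that)
  have "\<exists>x y. \<forall>e e'. coeff_hom.residual (\<lambda>c. [:c:]) n (roabp_poly B)
      (\<lambda>k. if k \<in> D then \<beta> e' k else \<alpha> e k) = (\<Sum>k<Suc (r ^ 4 * Suc d). x k e * y k e')"
    by (rule coeff_hom.roabp_residual_rank[OF hom B T _ _ AD(1,2) sep]) (fact pos \<alpha>)+
  then obtain x y where "\<forall>e e'. coeff_hom.residual (\<lambda>c. [:c:]) n (roabp_poly B)
      (\<lambda>k. if k \<in> D then \<beta> e' k else \<alpha> e k) = (\<Sum>k<Suc (r ^ 4 * Suc d). x k e * y k e')"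
    by blast
  then have xy: "(\<Sum>k<Suc (r ^ 4 * Suc d). x k e * y k e') = 0 \<longleftrightarrow> e \<noteq> e'" if "e \<subseteq> A" "e' \<subseteq> A" for e e'
    using diag[OF that] by (simp only:)
  have fin: "finite A"
    using AD(1) finite_subset by blast
  have "card (Pow A) \<le> Suc (r ^ 4 * Suc d)"
  proof (rule card_le_rank_of_diagonal[where x = x and y = y])
    show "finite (Pow A)" using fin by simp
  next
    fix e e' assume "e \<in> Pow A" "e' \<in> Pow A" "e \<noteq> e'"
    then show "(\<Sum>k<Suc (r ^ 4 * Suc d). x k e * y k e') = 0"
      using xy[of e e'] by blast
  next
    fix e assume "e \<in> Pow A"
    then show "(\<Sum>k<Suc (r ^ 4 * Suc d). x k e * y k e) \<noteq> 0"
      using xy[of e e] by blast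
  qed
  then show ?thesis
    using coeff_hom.refutation_degree_pos[OF hom assms] by (simp add: card_Pow fin AD(4))
qed

lemma size_bound:
  fixes n N r d :: nat
  assumes "1 \<le> d" "1 \<le> r" "2 \<le> N" "2 ^ (n div 32) \<le> Suc (r ^ 4 * Suc d)"
  shows "exp (hardness_const * real n) \<le> real (roabp_size N r d)"
proof -
  define S where "S = roabp_size N r d"
  have "2 * 2 * (r * d) \<le> N * N * (r * d)"
    using assms(3) by (intro mult_right_mono mult_mono) auto
  then have S4: "4 * (r * d) \<le> S"
    by (simp add: S_def roabp_size_def mult_ac)
  have rd: "1 \<le> r * d"
    using assms(1,2) by simp
  show ?thesis
  proof (cases "n < 32")
    case True
    then have "exp (hardness_const * real n) \<le> exp 1"
      by (simp add: hardness_const_def)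
    also have "\<dots> \<le> 3" by (rule exp_le)
    also have "\<dots> \<le> real S"
      using S4 rd by linarith
    finally show ?thesis by (simp add: S_def)
  next
    case False
    define m where "m = n div 32"
    have nm: "n \<le> 64 * m"
      using False unfolding m_def by presburger
    have "1 \<le> r ^ 4" "r ^ 4 * 1 \<le> r ^ 4 * d"
      using assms(1,2) by simp_all
    then have "Suc (r ^ 4 * Suc d) \<le> 4 * (r ^ 4 * d)"
      unfolding mult_Suc_right by linarith
    also have "\<dots> \<le> (4 * (r * d)) ^ 4"
      unfolding power_mult_distrib using assms(1) by (intro mult_le_mono self_le_power) simp_all
    also have "\<dots> \<le> S ^ 4"
      using S4 by (rule power_mono) simp
    finally have "2 ^ m \<le> S ^ 4"
      using assms(4) unfolding m_def by linarith
    then have "real (2 ^ m) \<le> real (S ^ 4)"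
      by (simp only: of_nat_le_iff)
    then have 2: "2 ^ m \<le> real S ^ 4"
      by simp
    have "exp (hardness_const * real n) ^ 4 = exp (real n / 2500)"
      by (simp add: hardness_const_def flip: exp_of_nat_mult)
    also have "\<dots> \<le> exp (real m * (1 / 2))"
      using nm by simp
    also have "\<dots> = exp (1 / 2) ^ m"
      by (simp only: exp_of_nat_mult)
    also have "\<dots> \<le> 2 ^ m"
      using exp_half_le2 by (intro power_mono) simp_all
    also note 2
    finally have "exp (hardness_const * real n) ^ 4 \<le> real S ^ 4" .
    then show ?thesis
      using power_mono_iff[of "exp (hardness_const * real n)" "real S" 4] by (simp only: S_def) simp
  qed
qed

theorem corollary7p3:
  fixes n :: nat
  assumes "CHAR('a::field) = 0 \<or> CHAR('a) > n"
  shows "unsatisfiable ({hard_f n, hard_g n} \<union> bool_axiom ` {1..n} :: (nat, 'a) mpoly set) \<and>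
    (\<forall>(B :: (ips_var, 'v, 'a) roabp) r d.
       roabp_ips_refutation n (hard_f n) (hard_g n) r d B \<longrightarrow>
       exp (hardness_const * real n) \<le> real (roabp_size (num_vars B) r d))"
proof (intro conjI allI impI)
  show "unsatisfiable ({hard_f n, hard_g n} \<union> bool_axiom ` {1..n} :: (nat, 'a) mpoly set)"
    by (rule hard_system_unsatisfiable[OF assms])
next
  fix B :: "(ips_var, 'v, 'a) roabp" and r d
  assume ref: "roabp_ips_refutation n (hard_f n) (hard_g n) r d B"
  then have B: "is_roabp (ips_vars n) r d B"
    by (simp add: roabp_ips_refutation_def)
  then obtain s where s: "layer B 0 = {s}" "card (layer B 0) \<le> r"
    by (auto simp: is_roabp_def)
  have "card {YVar, ZVar} \<le> card (set (var_order B))"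
    using B by (intro card_mono) (auto simp: is_roabp_def ips_vars_def)
  then have "2 \<le> num_vars B"
    using card_length[of "var_order B"] by (simp add: num_vars_def)
  then show "exp (hardness_const * real n) \<le> real (roabp_size (num_vars B) r d)"
    using refutation_rank[OF ref] s by (intro size_bound) auto
qed

end
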